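(* Let $y_M(\cdot)$ be the multi-resolution approximation ($M$-RA) of $y_0(\cdot)\sim GP(0,C_0)$ on $\mathcal{D}$ based on knots $\mathcal{Q}_0,\ldots,\mathcal{Q}_M$ and modulating functions $T_0,\ldots,T_M$. Then $y_M(\cdot)$ is a Gaussian process, $y_M(\cdot)\sim GP(0,C_M)$, with mean zero and covariance function $$C_M(\mathbf{s}_1,\mathbf{s}_2)=\sum_{m=0}^{M} v_m(\mathbf{s}_1,\mathcal{Q}_m)\,v_m(\mathcal{Q}_m,\mathcal{Q}_m)^{-1}\,v_m(\mathcal{Q}_m,\mathbf{s}_2),\qquad \mathbf{s}_1,\mathbf{s}_2\in\mathcal{D}.$$
   Context: Let $\mathcal{D}\subset\mathbb{R}^d$ with $d\ge 1$, let $C_0$ be a positive-definite covariance function on $\mathcal{D}$, and let $y_0(\cdot)\sim GP(0,C_0)$ be a zero-mean Gaussian process on $\mathcal{D}$. Let $M\in\mathbb{N}$. For $m=0,\ldots,M$, $\mathcal{Q}_m=\{\mathbf{q}_{m,1},\ldots,\mathbf{q}_{m,r_m}\}\subset\mathcal{D}$ is a finite set of $r_m$ knots, with $r_0<r_1<\cdots<r_M$. For $m=0,\ldots,M$, the modulating function $T_m:\mathcal{D}\times\mathcal{D}\to[0,1]$ is a symmetric nonnegative-definite function with $T_m(\mathbf{s},\mathbf{s})=1$ for all $\mathbf{s}$ (and equal to $0$ at pairs of locations that are sufficiently far apart, where "far" depends on $m$). For finite sets $A,B\subset\mathcal{D}$ and a function $f$ on $\mathcal{D}\times\mathcal{D}$,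 $f(A,B)$ denotes the matrix of values of $f$; similarly $f(\mathbf{s},B)$ is a row vector and $f(A,\mathbf{s})$ a column vector. Define recursively $v_0(\mathbf{s}_1,\mathbf{s}_2)=C_0(\mathbf{s}_1,\mathbf{s}_2)\,T_0(\mathbf{s}_1,\mathbf{s}_2)$; for $m=0,\ldots,M$, $\mathbf{b}_m(\mathbf{s})'=v_m(\mathbf{s},\mathcal{Q}_m)$ and $\boldsymbol{\Lambda}_m=v_m(\mathcal{Q}_m,\mathcal{Q}_m)$; and for $m=0,\ldots,M-1$, $$v_{m+1}(\mathbf{s}_1,\mathbf{s}_2)=\big(v_m(\mathbf{s}_1,\mathbf{s}_2)-\mathbf{b}_m(\mathbf{s}_1)'\boldsymbol{\Lambda}_m^{-1}\mathbf{b}_m(\mathbf{s}_2)\big)\cdot T_{m+1}(\mathbf{s}_1,\mathbf{s}_2).$$ The matrices $\boldsymbol{\Lambda}_m$ are assumed invertible. The $M$-RA of $y_0(\cdot)$ is the process $y_M(\mathbf{s})=\sum_{m=0}^M \mathbf{b}_m(\mathbf{s})'\boldsymbol{\eta}_m$, $\mathbf{s}\in\mathcal{D}$, where $\boldsymbol{\eta}_0,\ldots,\boldsymbol{\eta}_M$ are independent with $\boldsymbol{\eta}_m\sim\mathcal{N}_{r_m}(\mathbf{0},\boldsymbol{\Lambda}_m^{-1})$. *)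

theory Defs
  imports
    "HOL-Probability.Probability"
    "Jordan_Normal_Form.Gauss_Jordan_Elimination"
begin

text \<open>Kernels are total functions that are only constrained on the domain \<open>D\<close>.\<close>

definition symmetric_on :: "'a set \<Rightarrow> ('a \<Rightarrow> 'a \<Rightarrow> real) \<Rightarrow> bool" where
  "symmetric_on D K \<longleftrightarrow> (\<forall>s\<in>D. \<forall>t\<in>D. K s t = K t s)"

definition nonneg_definite_on :: "'a set \<Rightarrow> ('a \<Rightarrow> 'a \<Rightarrow> real) \<Rightarrow> bool" where
  "nonneg_definite_on D K \<longleftrightarrow>
     (\<forall>S a. finite S \<and> S \<subseteq> D \<longrightarrow> 0 \<le> (\<Sum>s\<in>S. \<Sum>t\<in>S. a s * a t * K s t))"

definition pos_definite_on :: "'a set \<Rightarrow> ('a \<Rightarrow> 'a \<Rightarrow> real) \<Rightarrow> bool" where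
  "pos_definite_on D K \<longleftrightarrow>
     (\<forall>S a. finite S \<and> S \<subseteq> D \<and> (\<exists>s\<in>S. a s \<noteq> 0)
        \<longrightarrow> 0 < (\<Sum>s\<in>S. \<Sum>t\<in>S. a s * a t * K s t))"

definition modulating_function :: "'a::metric_space set \<Rightarrow> ('a \<Rightarrow> 'a \<Rightarrow> real) \<Rightarrow> bool" where
  "modulating_function D T \<longleftrightarrow>
     (\<forall>s\<in>D. \<forall>t\<in>D. T s t \<in> {0..1}) \<and>
     symmetric_on D T \<and> nonneg_definite_on D T \<and>
     (\<forall>s\<in>D. T s s = 1) \<and>
     (\<exists>R. \<forall>s\<in>D. \<forall>t\<in>D. R < dist s t \<longrightarrow> T s t = 0)"

text \<open>A univariate normal variable may have variance \<open>0\<close>; then it is almost surely constant and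
  has no Lebesgue density.\<close>

definition univariate_normal :: "'w measure \<Rightarrow> ('w \<Rightarrow> real) \<Rightarrow> bool" where
  "univariate_normal P X \<longleftrightarrow>
     X \<in> borel_measurable P \<and>
     ((\<exists>c. AE w in P. X w = c) \<or>
      (\<exists>c \<sigma>. 0 < \<sigma> \<and> distributed P lborel X (normal_density c \<sigma>)))"

text \<open>The vector \<open>(X i)\<close>, \<open>i \<in> I\<close>, has distribution \<open>N(\<mu>, \<Sigma>)\<close>, where \<open>\<Sigma>\<close> may be singular: all linear
  combinations are univariate normal, and \<open>\<mu>\<close> and \<open>\<Sigma>\<close> are the mean vector and the covariance
  matrix. Normality makes the integrands below integrable, so the integrals are
  genuine expectations.\<close>

definition multivariate_normal ::
  "'w measure \<Rightarrow> 'i set \<Rightarrow> ('i \<Rightarrow> 'w \<Rightarrow> real) \<Rightarrow> ('i \<Rightarrow> real) \<Rightarrow> ('i \<Rightarrow> 'i \<Rightarrow> real) \<Rightarrow> bool" where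
  "multivariate_normal P I X \<mu> \<Sigma> \<longleftrightarrow>
     prob_space P \<and> finite I \<and>
     (\<forall>i\<in>I. X i \<in> borel_measurable P) \<and>
     (\<forall>a. univariate_normal P (\<lambda>w. \<Sum>i\<in>I. a i * X i w)) \<and>
     (\<forall>i\<in>I. (\<integral>w. X i w \<partial>P) = \<mu> i) \<and>
     (\<forall>i\<in>I. \<forall>j\<in>I. (\<integral>w. (X i w - \<mu> i) * (X j w - \<mu> j) \<partial>P) = \<Sigma> i j)"

definition gaussian_process ::
  "'w measure \<Rightarrow> 'a set \<Rightarrow> ('a \<Rightarrow> 'w \<Rightarrow> real) \<Rightarrow> ('a \<Rightarrow> real) \<Rightarrow> ('a \<Rightarrow> 'a \<Rightarrow> real) \<Rightarrow> bool" where
  "gaussian_process P D y \<mu> C \<longleftrightarrow>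
     prob_space P \<and>
     (\<forall>S. finite S \<and> S \<subseteq> D \<longrightarrow> multivariate_normal P S y \<mu> C)"

text \<open>The matrix \<open>f(A, B)\<close>, the row \<open>f(s, B)\<close> and the column \<open>f(A, s)\<close>, for finite sets of locations
  enumerated as lists.\<close>

definition kernel_mat :: "('a \<Rightarrow> 'a \<Rightarrow> real) \<Rightarrow> 'a list \<Rightarrow> 'a list \<Rightarrow> real mat" where
  "kernel_mat f A B = mat (length A) (length B) (\<lambda>(i, j). f (A ! i) (B ! j))"

definition kernel_row :: "('a \<Rightarrow> 'a \<Rightarrow> real) \<Rightarrow> 'a \<Rightarrow> 'a list \<Rightarrow> real Matrix.vec" where
  "kernel_row f s B = Matrix.vec (length B) (\<lambda>j. f s (B ! j))"

definition kernel_col :: "('a \<Rightarrow> 'a \<Rightarrow> real) \<Rightarrow> 'a list \<Rightarrow> 'a \<Rightarrow> real Matrix.vec" where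
  "kernel_col f A s = Matrix.vec (length A) (\<lambda>i. f (A ! i) s)"

text \<open>Meaningful only for invertible \<open>A\<close>, where \<open>mat_inverse\<close> does not return \<open>None\<close>.\<close>

definition inv_mat :: "real mat \<Rightarrow> real mat" where
  "inv_mat A = the (mat_inverse A)"

text \<open>The kernels \<open>v\<^sub>m\<close>. The vector \<open>b\<^sub>m(s)\<close> is \<open>kernel_row v\<^sub>m s (Q m)\<close> and
  \<open>\<Lambda>\<^sub>m\<close> is \<open>kernel_mat v\<^sub>m (Q m) (Q m)\<close>.\<close>

primrec mra_v ::
  "('a \<Rightarrow> 'a \<Rightarrow> real) \<Rightarrow> (nat \<Rightarrow> 'a \<Rightarrow> 'a \<Rightarrow> real) \<Rightarrow> (nat \<Rightarrow> 'a list) \<Rightarrow> nat \<Rightarrow> 'a \<Rightarrow> 'a \<Rightarrow> real" where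
  "mra_v C0 T Q 0 = (\<lambda>s t. C0 s t * T 0 s t)"
| "mra_v C0 T Q (Suc m) = (\<lambda>s t.
     (mra_v C0 T Q m s t
        - kernel_row (mra_v C0 T Q m) s (Q m)
          \<bullet> (inv_mat (kernel_mat (mra_v C0 T Q m) (Q m) (Q m))
              *\<^sub>v kernel_row (mra_v C0 T Q m) t (Q m)))
     * T (Suc m) s t)"

definition mra_b ::
  "('a \<Rightarrow> 'a \<Rightarrow> real) \<Rightarrow> (nat \<Rightarrow> 'a \<Rightarrow> 'a \<Rightarrow> real) \<Rightarrow> (nat \<Rightarrow> 'a list) \<Rightarrow> nat \<Rightarrow> 'a \<Rightarrow> real Matrix.vec" where
  "mra_b C0 T Q m s = kernel_row (mra_v C0 T Q m) s (Q m)"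

definition mra_Lambda ::
  "('a \<Rightarrow> 'a \<Rightarrow> real) \<Rightarrow> (nat \<Rightarrow> 'a \<Rightarrow> 'a \<Rightarrow> real) \<Rightarrow> (nat \<Rightarrow> 'a list) \<Rightarrow> nat \<Rightarrow> real mat" where
  "mra_Lambda C0 T Q m = kernel_mat (mra_v C0 T Q m) (Q m) (Q m)"

text \<open>The process \<open>y\<^sub>M\<close>; the entries of the weight vector \<open>\<eta>\<^sub>m\<close> are \<open>\<eta> m i\<close>, \<open>i < length (Q m)\<close>.\<close>

definition mra_process ::
  "('a \<Rightarrow> 'a \<Rightarrow> real) \<Rightarrow> (nat \<Rightarrow> 'a \<Rightarrow> 'a \<Rightarrow> real) \<Rightarrow> (nat \<Rightarrow> 'a list) \<Rightarrow> nat
     \<Rightarrow> (nat \<Rightarrow> nat \<Rightarrow> 'w \<Rightarrow> real) \<Rightarrow> 'a \<Rightarrow> 'w \<Rightarrow> real" where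
  "mra_process C0 T Q M \<eta> s w =
     (\<Sum>m\<le>M. mra_b C0 T Q m s \<bullet> Matrix.vec (length (Q m)) (\<lambda>i. \<eta> m i w))"

end

theory Submission
  imports Defs
begin

text \<open>For fixed locations, each level \<open>b\<^sub>m(s)' \<eta>\<^sub>m\<close> is a linear image of a Gaussian vector, and the
  levels are independent, so their sum is Gaussian and the covariances add. This gives the
  covariance with \<open>v\<^sub>m(s\<^sub>2, Q\<^sub>m)\<close> in place of \<open>v\<^sub>m(Q\<^sub>m, s\<^sub>2)\<close>; the two agree because \<open>v\<^sub>m\<close> is
  symmetric, by induction on \<open>m\<close>.\<close>

section \<open>Univariate normal laws, including the degenerate ones\<close>

lemma univariate_normal_measurable:
  "univariate_normal P X \<Longrightarrow> X \<in> borel_measurable P"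
  by (simp add: univariate_normal_def)

lemma univariate_normal_cases:
  assumes "univariate_normal P X"
  obtains (degenerate) c where "AE w in P. X w = c"
  | (density) c \<sigma> where "0 < \<sigma>" "distributed P lborel X (normal_density c \<sigma>)"
  using assms by (auto simp: univariate_normal_def)

text \<open>A degenerate summand is only almost surely constant, so a sum containing it agrees with
  a shift of the other summand only almost everywhere. Measurability of \<open>X\<close> is a
  separate premise, since \<open>P\<close> may be incomplete.\<close>

lemma univariate_normal_cong_AE:
  assumes Y: "univariate_normal P Y"
    and X: "X \<in> borel_measurable P"
    and eq: "AE w in P. X w = Y w"
  shows "univariate_normal P X"
  using Y
proof (cases rule: univariate_normal_cases)
  case (degenerate c)
  with eq have "AE w in P. X w = c" by eventually_elim simp
  with X show ?thesis by (auto simp: univariate_normal_def)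
next
  case (density c \<sigma>)
  have "distr P lborel X = distr P lborel Y"
    using X univariate_normal_measurable[OF Y] eq by (intro distr_cong_AE) auto
  with density X have "distributed P lborel X (normal_density c \<sigma>)"
    by (simp add: distributed_def)
  with density X show ?thesis by (auto simp: univariate_normal_def)
qed

context prob_space
begin

lemma univariate_normal_add_const:
  assumes "univariate_normal M X"
  shows "univariate_normal M (\<lambda>w. c + X w)"
  using assms
proof (cases rule: univariate_normal_cases)
  case (degenerate d)
  then have "AE w in M. c + X w = c + d" by eventually_elim simp
  with univariate_normal_measurable[OF assms] show ?thesis
    by (auto simp: univariate_normal_def)
next
  case (density d \<sigma>)
  then have "distributed M lborel (\<lambda>w. c + X w) (normal_density (c + d) \<sigma>)"
    using normal_density_affine[of X d \<sigma> 1 c] by simp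
  with density univariate_normal_measurable[OF assms] show ?thesis
    by (auto simp: univariate_normal_def)
qed

text \<open>If one summand is almost surely constant, the sum is a shift of the other one almost
  everywhere. Otherwise both have normal densities, and independence makes the density of the sum
  their convolution.\<close>

lemma univariate_normal_add_indep:
  assumes X: "univariate_normal M X" and Y: "univariate_normal M Y"
    and indep: "indep_var borel X borel Y"
  shows "univariate_normal M (\<lambda>w. X w + Y w)"
proof -
  have meas: "(\<lambda>w. X w + Y w) \<in> borel_measurable M"
    using univariate_normal_measurable[OF X] univariate_normal_measurable[OF Y] by measurable
  from X show ?thesis
  proof (cases rule: univariate_normal_cases)
    case (degenerate c)
    then have "AE w in M. X w + Y w = c + Y w" by eventually_elim simp
    with univariate_normal_add_const[OF Y] meas show ?thesis
      by (rule univariate_normal_cong_AE)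
  next
    case X': (density c \<sigma>)
    from Y show ?thesis
    proof (cases rule: univariate_normal_cases)
      case (degenerate d)
      then have "AE w in M. X w + Y w = d + X w" by eventually_elim simp
      with univariate_normal_add_const[OF X] meas show ?thesis
        by (rule univariate_normal_cong_AE)
    next
      case (density d \<tau>)
      with X' indep have
        "distributed M lborel (\<lambda>w. X w + Y w) (normal_density (c + d) (sqrt (\<sigma>\<^sup>2 + \<tau>\<^sup>2)))"
        by (intro add_indep_normal) auto
      moreover have "0 < sqrt (\<sigma>\<^sup>2 + \<tau>\<^sup>2)"
        using X' by (simp add: add_pos_nonneg)
      ultimately show ?thesis
        using meas unfolding univariate_normal_def by blast
    qed
  qed
qed

lemma univariate_normal_sum_indep:
  assumes "finite I" "indep_vars (\<lambda>_. borel) X I"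
    and "\<And>i. i \<in> I \<Longrightarrow> univariate_normal M (X i)"
  shows "univariate_normal M (\<lambda>w. \<Sum>i\<in>I. X i w)"
  using assms
proof (induction I)
  case empty
  then show ?case by (auto simp: univariate_normal_def)
next
  case (insert i I)
  then have "univariate_normal M (\<lambda>w. X i w + (\<Sum>i\<in>I. X i w))"
    by (intro univariate_normal_add_indep indep_vars_sum insert.IH)
       (auto intro: indep_vars_subset)
  with insert.hyps show ?case by simp
qed

text \<open>The Bochner integral of a non-integrable function is 0 by convention, so means and
  covariances of sums can be computed by linearity only once first and second moments are known to
  exist.\<close>

lemma univariate_normal_integrable:
  assumes "univariate_normal M X"
  shows "integrable M X" and "integrable M (\<lambda>w. (X w)\<^sup>2)"
proof -
  note [measurable] = univariate_normal_measurable[OF assms]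
  have "integrable M X \<and> integrable M (\<lambda>w. (X w)\<^sup>2)"
    using assms
  proof (cases rule: univariate_normal_cases)
    case (degenerate c)
    then have 1: "AE w in M. norm (X w) \<le> \<bar>c\<bar>" and 2: "AE w in M. norm ((X w)\<^sup>2) \<le> c\<^sup>2"
      by (eventually_elim, simp)+
    show ?thesis
      by (intro conjI integrable_const_bound[OF 1] integrable_const_bound[OF 2]) measurable
  next
    case (density c \<sigma>)
    have X: "integrable M X"
      by (rule distributed_integrable_var[OF density(2)])
         (use density(1) in \<open>auto intro: integrable_normal_moment_nz_1\<close>)
    have "integrable M (\<lambda>w. (X w - c)\<^sup>2)"
      by (subst distributed_integrable[OF density(2), symmetric])
         (use integrable_normal_moment[OF density(1)] in auto)
    \<comment> \<open>The normal moments are available about the mean \<open>c\<close>; this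
      combination equals the square of \<open>X\<close>.\<close>
    then have "integrable M (\<lambda>w. (X w - c)\<^sup>2 + 2 * c * X w - c\<^sup>2)"
      using X by (intro Bochner_Integration.integrable_diff Bochner_Integration.integrable_add
        integrable_mult_right) auto
    with X show ?thesis by (simp add: power2_eq_square algebra_simps)
  qed
  then show "integrable M X" and "integrable M (\<lambda>w. (X w)\<^sup>2)" by auto
qed

text \<open>By 2|xy| \<le> x^2 + y^2 the product is dominated by an integrable function. This covers
  the covariances of dependent entries of one Gaussian vector.\<close>

lemma integrable_mult_of_squares:
  fixes X Y :: "'a \<Rightarrow> real"
  assumes [measurable]: "X \<in> borel_measurable M" "Y \<in> borel_measurable M"
    and "integrable M (\<lambda>w. (X w)\<^sup>2)" "integrable M (\<lambda>w. (Y w)\<^sup>2)"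
  shows "integrable M (\<lambda>w. X w * Y w)"
proof (rule Bochner_Integration.integrable_bound)
  show "integrable M (\<lambda>w. (X w)\<^sup>2 + (Y w)\<^sup>2)" using assms by simp
  have "norm (x * y) \<le> norm (x\<^sup>2 + y\<^sup>2)" for x y :: real
  proof -
    have "2 * (\<bar>x\<bar> * \<bar>y\<bar>) \<le> x\<^sup>2 + y\<^sup>2"
      using sum_squares_bound[of "\<bar>x\<bar>" "\<bar>y\<bar>"] by simp
    moreover have "0 \<le> \<bar>x\<bar> * \<bar>y\<bar>" by simp
    ultimately have "\<bar>x\<bar> * \<bar>y\<bar> \<le> x\<^sup>2 + y\<^sup>2" by linarith
    then show ?thesis by (simp add: abs_mult)
  qed
  then show "AE w in M. norm (X w * Y w) \<le> norm ((X w)\<^sup>2 + (Y w)\<^sup>2)" by blast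
qed measurable

end

section \<open>Gaussian vectors: marginals, linear images and independent sums\<close>

lemma multivariate_normalD:
  assumes "multivariate_normal P I X \<mu> \<Sigma>"
  shows "prob_space P" "finite I"
    and "i \<in> I \<Longrightarrow> X i \<in> borel_measurable P"
    and "univariate_normal P (\<lambda>w. \<Sum>i\<in>I. a i * X i w)"
    and "i \<in> I \<Longrightarrow> (\<integral>w. X i w \<partial>P) = \<mu> i"
    and "i \<in> I \<Longrightarrow> j \<in> I \<Longrightarrow> (\<integral>w. (X i w - \<mu> i) * (X j w - \<mu> j) \<partial>P) = \<Sigma> i j"
  using assms by (simp_all add: multivariate_normal_def)

lemma multivariate_normal_marginal:
  assumes "multivariate_normal P I X \<mu> \<Sigma>" "i \<in> I"
  shows "univariate_normal P (X i)"
  \<comment> \<open>The coefficients vanish except at \<open>i\<close>, so the linear combination is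
    \<open>X i\<close> itself.\<close>
  using multivariate_normalD(4)[OF assms(1), of "\<lambda>j. of_bool (j = i)"]
    multivariate_normalD(2)[OF assms(1)] assms(2)
  by simp

lemma multivariate_normal_integrable:
  assumes N: "multivariate_normal P I X \<mu> \<Sigma>" and i: "i \<in> I"
  shows "integrable P (X i)"
    and "j \<in> I \<Longrightarrow> integrable P (\<lambda>w. (X i w - \<mu> i) * (X j w - \<mu> j))"
proof -
  interpret prob_space P by (rule multivariate_normalD(1)[OF N])
  have U: "univariate_normal P (\<lambda>w. X k w - \<mu> k)" if "k \<in> I" for k
    using univariate_normal_add_const[OF multivariate_normal_marginal[OF N that], of "- \<mu> k"]
    by simp
  show "integrable P (X i)"
    by (rule univariate_normal_integrable(1)[OF multivariate_normal_marginal[OF N i]])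
  show "integrable P (\<lambda>w. (X i w - \<mu> i) * (X j w - \<mu> j))" if "j \<in> I"
    using U[OF i] U[OF that]
    by (intro integrable_mult_of_squares univariate_normal_measurable univariate_normal_integrable)
qed

text \<open>A linear combination of linear images is again one of the \<open>X i\<close>, and the
  moments follow by linearity. The image may be singular, for instance when \<open>J\<close> has
  more elements than \<open>I\<close>; \<open>multivariate_normal\<close> allows this.\<close>

lemma multivariate_normal_linear_image:
  assumes N: "multivariate_normal P I X \<mu> \<Sigma>" and J: "finite J"
  shows "multivariate_normal P J (\<lambda>s w. \<Sum>i\<in>I. b s i * X i w) (\<lambda>s. \<Sum>i\<in>I. b s i * \<mu> i)
    (\<lambda>s t. \<Sum>i\<in>I. \<Sum>j\<in>I. b s i * b t j * \<Sigma> i j)"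
  unfolding multivariate_normal_def
proof (intro conjI ballI allI)
  note D = multivariate_normalD[OF N]
  note int = multivariate_normal_integrable[OF N]
  show "prob_space P" and "finite J" by fact+
  show "(\<lambda>w. \<Sum>i\<in>I. b s i * X i w) \<in> borel_measurable P" for s
    by (intro univariate_normal_measurable D)
  show "univariate_normal P (\<lambda>w. \<Sum>s\<in>J. a s * (\<Sum>i\<in>I. b s i * X i w))" for a
  proof -
    have "(\<Sum>s\<in>J. a s * (\<Sum>i\<in>I. b s i * X i w)) = (\<Sum>i\<in>I. (\<Sum>s\<in>J. a s * b s i) * X i w)" for w
      by (simp add: sum_distrib_left sum_distrib_right mult.assoc sum.swap[of _ I J])
    then show ?thesis using D(4) by simp
  qed
  show "(\<integral>w. (\<Sum>i\<in>I. b s i * X i w) \<partial>P) = (\<Sum>i\<in>I. b s i * \<mu> i)" for s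
    by (simp add: Bochner_Integration.integral_sum int D(5))
  show "(\<integral>w. ((\<Sum>i\<in>I. b s i * X i w) - (\<Sum>i\<in>I. b s i * \<mu> i))
          * ((\<Sum>i\<in>I. b t i * X i w) - (\<Sum>i\<in>I. b t i * \<mu> i)) \<partial>P)
      = (\<Sum>i\<in>I. \<Sum>j\<in>I. b s i * b t j * \<Sigma> i j)" for s t
  proof -
    have "((\<Sum>i\<in>I. b s i * X i w) - (\<Sum>i\<in>I. b s i * \<mu> i))
          * ((\<Sum>i\<in>I. b t i * X i w) - (\<Sum>i\<in>I. b t i * \<mu> i))
      = (\<Sum>i\<in>I. \<Sum>j\<in>I. b s i * b t j * ((X i w - \<mu> i) * (X j w - \<mu> j)))" for w
      by (simp add: sum_subtractf[symmetric] right_diff_distrib[symmetric] sum_product)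
         (simp only: mult_ac)
    then show ?thesis
      by (simp add: Bochner_Integration.integral_sum int D(6))
  qed
qed

text \<open>Independence is between whole vectors, while the entries of one vector may be dependent.
  Measurable functions of the separate vectors inherit it: linear forms give normality of the sum,
  single coordinates give vanishing cross-covariances. Restricting to \<open>S\<close> makes each
  vector a point of the product space.\<close>

lemma (in prob_space) multivariate_normal_sum_indep:
  assumes I: "finite I" and S: "finite S"
    and N: "\<And>m. m \<in> I \<Longrightarrow> multivariate_normal M S (X m) (\<mu> m) (\<Sigma> m)"
    and indep: "indep_vars (\<lambda>_. \<Pi>\<^sub>M s\<in>S. borel) (\<lambda>m w. \<lambda>s\<in>S. X m s w) I"
  shows "multivariate_normal M S (\<lambda>s w. \<Sum>m\<in>I. X m s w) (\<lambda>s. \<Sum>m\<in>I. \<mu> m s)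
    (\<lambda>s t. \<Sum>m\<in>I. \<Sigma> m s t)"
  unfolding multivariate_normal_def
proof (intro conjI ballI allI)
  note D = multivariate_normalD[OF N]
  note int = multivariate_normal_integrable[OF N]
  show "prob_space M" by unfold_locales
  show "finite S" by fact
  show "(\<lambda>w. \<Sum>m\<in>I. X m s w) \<in> borel_measurable M" if "s \<in> S" for s
    using D(3) that by (intro borel_measurable_sum) auto
  show "univariate_normal M (\<lambda>w. \<Sum>s\<in>S. a s * (\<Sum>m\<in>I. X m s w))" for a
  proof -
    have "indep_vars (\<lambda>_. borel) (\<lambda>m w. \<Sum>s\<in>S. a s * (\<lambda>s\<in>S. X m s w) s) I"
      by (rule indep_vars_compose2[OF indep, of "\<lambda>_ f. \<Sum>s\<in>S. a s * f s"]) simp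
    then have "univariate_normal M (\<lambda>w. \<Sum>m\<in>I. \<Sum>s\<in>S. a s * X m s w)"
      using D(4) by (intro univariate_normal_sum_indep[OF I]) auto
    then show ?thesis by (simp add: sum_distrib_left sum.swap[of _ S I])
  qed
  show "(\<integral>w. (\<Sum>m\<in>I. X m s w) \<partial>M) = (\<Sum>m\<in>I. \<mu> m s)" if "s \<in> S" for s
    using that by (simp add: Bochner_Integration.integral_sum int D(5))
  show "(\<integral>w. ((\<Sum>m\<in>I. X m s w) - (\<Sum>m\<in>I. \<mu> m s))
          * ((\<Sum>m\<in>I. X m t w) - (\<Sum>m\<in>I. \<mu> m t)) \<partial>M) = (\<Sum>m\<in>I. \<Sigma> m s t)"
    if s: "s \<in> S" and t: "t \<in> S" for s t
  proof -
    define Z where "Z m u w = X m u w - \<mu> m u" for m u w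
    have Z: "integrable M (Z m u)" "(\<integral>w. Z m u w \<partial>M) = 0" if "m \<in> I" "u \<in> S" for m u
      using int(1)[OF that] D(5)[OF that] by (simp_all add: Z_def[abs_def] prob_space)
    have cross: "integrable M (\<lambda>w. Z m s w * Z n t w)
        \<and> (\<integral>w. Z m s w * Z n t w \<partial>M) = (if m = n then \<Sigma> m s t else 0)"
      if m: "m \<in> I" and n: "n \<in> I" for m n
    proof (cases "m = n")
      case True
      then show ?thesis
        using int(2)[OF m s t] D(6)[OF m s t] by (simp add: Z_def)
    next
      case False
      \<comment> \<open>One family must contain both variables, so coordinate \<open>s\<close> is
        read off the vector \<open>m\<close> and coordinate \<open>t\<close> off every other
        vector.\<close>
      have "indep_vars (\<lambda>_. borel) (\<lambda>k w. if k = m then (\<lambda>s\<in>S. X k s w) s - \<mu> k s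
          else (\<lambda>s\<in>S. X k s w) t - \<mu> k t) I"
        by (rule indep_vars_compose2[OF indep,
            of "\<lambda>k f. if k = m then f s - \<mu> k s else f t - \<mu> k t"]) (use s t in auto)
      then have "indep_vars (\<lambda>_. borel) (\<lambda>k w. if k = m then Z k s w else Z k t w) I"
        unfolding Z_def restrict_apply'[OF s] restrict_apply'[OF t] .
      then have "indep_vars (\<lambda>_. borel) (\<lambda>k w. if k = m then Z k s w else Z k t w) (insert m {n})"
        by (rule indep_vars_subset) (use m n in auto)
      \<comment> \<open>The sum over the singleton \<open>{n}\<close> has one term, which turns
        independence of the two-member family into \<open>indep_var\<close>.\<close>
      from indep_vars_sum[OF _ _ this] False have "indep_var borel (Z m s) borel (Z n t)"
        by simp
      with indep_var_integrable[OF _ Z(1)[OF m s] Z(1)[OF n t]]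
        indep_var_lebesgue_integral[OF _ Z(1)[OF m s] Z(1)[OF n t]] False
      show ?thesis by (simp add: Z m n s t)
    qed
    have "((\<Sum>m\<in>I. X m s w) - (\<Sum>m\<in>I. \<mu> m s)) * ((\<Sum>m\<in>I. X m t w) - (\<Sum>m\<in>I. \<mu> m t))
        = (\<Sum>m\<in>I. \<Sum>n\<in>I. Z m s w * Z n t w)" for w
      by (simp add: Z_def sum_subtractf[symmetric] sum_product)
    then show ?thesis
      using I by (simp add: Bochner_Integration.integral_sum cross)
  qed
qed

section \<open>Symmetry of the kernels \<open>v\<^sub>m\<close> and the covariance of the
  process\<close>

lemma inv_mat_carrier:
  assumes A: "A \<in> carrier_mat n n" and inv: "invertible_mat A"
  shows "inv_mat A \<in> carrier_mat n n"
proof -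
  from inv obtain B where B: "inverts_mat A B" "inverts_mat B A"
    by (auto simp: invertible_mat_def)
  have AB: "A * B = 1\<^sub>m n" and BA: "B * A = 1\<^sub>m (dim_row B)"
    using A B by (auto simp: inverts_mat_def)
  \<comment> \<open>\<open>invertible_mat\<close> leaves the dimensions of the inverse open;
    comparing both products with identity matrices fixes them.\<close>
  have "dim_col B = n" using arg_cong[OF AB, of dim_col] by simp
  moreover have "dim_row B = n" using arg_cong[OF BA, of dim_col] A by simp
  ultimately have "A \<in> Units (ring_mat TYPE(real) n ())"
    using A AB BA by (auto simp: Units_def ring_mat_def intro!: bexI[of _ B])
  \<comment> \<open>\<open>mat_inverse\<close> returns \<open>None\<close> only for non-units of the
    matrix ring, so \<open>the\<close> in \<open>inv_mat\<close> meets a genuine value.\<close>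
  then obtain C where "mat_inverse A = Some C"
    using mat_inverse(1)[OF A, of "()"] by (cases "mat_inverse A") auto
  then show ?thesis using mat_inverse(2)[OF A] by (auto simp: inv_mat_def)
qed

text \<open>The double sum is the form in which \<open>multivariate_normal_linear_image\<close>
  delivers covariances, and in which the symmetry argument can exchange indices.\<close>

lemma scalar_prod_kernel_row_mult_mat:
  assumes "B \<in> carrier_mat (length q) (length q)"
  shows "kernel_row f s q \<bullet> (B *\<^sub>v kernel_row g t q)
    = (\<Sum>i<length q. \<Sum>j<length q. f s (q ! i) * g t (q ! j) * B $$ (i, j))"
  using assms
  by (auto simp: scalar_prod_def kernel_row_def lessThan_atLeast0 sum_distrib_left mult_ac
      intro!: sum.cong)

text \<open>The term subtracted at each level is a bilinear form in the rows at \<open>s\<close> and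
  \<open>t\<close>, so exchanging the two locations amounts to transposing its matrix. Symmetry of
  that matrix is a premise here; the theorem obtains it from the covariances of
  \<open>\<eta>\<close>.\<close>

lemma symmetric_on_mra_v:
  assumes C0: "symmetric_on D C0"
    and T: "\<And>k. k \<le> m \<Longrightarrow> symmetric_on D (T k)"
    and inv: "\<And>k i j. k < m \<Longrightarrow> i < length (Q k) \<Longrightarrow> j < length (Q k) \<Longrightarrow>
      inv_mat (mra_Lambda C0 T Q k) $$ (i, j) = inv_mat (mra_Lambda C0 T Q k) $$ (j, i)"
    and carrier: "\<And>k. k < m \<Longrightarrow>
      inv_mat (mra_Lambda C0 T Q k) \<in> carrier_mat (length (Q k)) (length (Q k))"
  shows "symmetric_on D (mra_v C0 T Q m)"
  using assms
proof (induction m)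
  case 0
  then show ?case by (simp add: symmetric_on_def)
next
  case (Suc m)
  let ?v = "mra_v C0 T Q m" and ?B = "inv_mat (mra_Lambda C0 T Q m)"
  have v: "symmetric_on D ?v" by (rule Suc.IH) (use Suc.prems in auto)
  have "(\<Sum>i<length (Q m). \<Sum>j<length (Q m). ?v s (Q m ! i) * ?v t (Q m ! j) * ?B $$ (i, j))
      = (\<Sum>i<length (Q m). \<Sum>j<length (Q m). ?v t (Q m ! i) * ?v s (Q m ! j) * ?B $$ (i, j))" for s t
    by (subst sum.swap) (auto intro!: sum.cong simp: Suc.prems(3))
  then have "kernel_row ?v s (Q m) \<bullet> (?B *\<^sub>v kernel_row ?v t (Q m))
      = kernel_row ?v t (Q m) \<bullet> (?B *\<^sub>v kernel_row ?v s (Q m))" for s t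
    by (simp add: scalar_prod_kernel_row_mult_mat Suc.prems(4))
  with v Suc.prems(2)[of "Suc m"] show ?case
    by (simp add: symmetric_on_def mra_Lambda_def)
qed

theorem proposition1:
  fixes D :: "(real ^ 'd) set"
    and C0 :: "real ^ 'd \<Rightarrow> real ^ 'd \<Rightarrow> real"
    and y0 :: "real ^ 'd \<Rightarrow> 'u \<Rightarrow> real"
    and P0 :: "'u measure"
    and M :: nat
    and Q :: "nat \<Rightarrow> (real ^ 'd) list"
    and T :: "nat \<Rightarrow> real ^ 'd \<Rightarrow> real ^ 'd \<Rightarrow> real"
    and P :: "'w measure"
    and \<eta> :: "nat \<Rightarrow> nat \<Rightarrow> 'w \<Rightarrow> real"
  assumes C0_sym: "symmetric_on D C0"
    and C0_pos: "pos_definite_on D C0"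
    and y0: "gaussian_process P0 D y0 (\<lambda>_. 0) C0"
    and knots: "\<And>m. m \<le> M \<Longrightarrow> distinct (Q m) \<and> set (Q m) \<subseteq> D"
    and knots_increasing: "\<And>m. m < M \<Longrightarrow> length (Q m) < length (Q (Suc m))"
    and modulating: "\<And>m. m \<le> M \<Longrightarrow> modulating_function D (T m)"
    and invertible: "\<And>m. m \<le> M \<Longrightarrow> invertible_mat (mra_Lambda C0 T Q m)"
    and prob: "prob_space P"
    and eta_normal: "\<And>m. m \<le> M \<Longrightarrow>
      multivariate_normal P {..<length (Q m)} (\<eta> m) (\<lambda>_. 0)
        (\<lambda>i j. inv_mat (mra_Lambda C0 T Q m) $$ (i, j))"
    and eta_indep: "prob_space.indep_vars P
      (\<lambda>m. \<Pi>\<^sub>M i\<in>{..<length (Q m)}. (borel :: real measure))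
      (\<lambda>m w. \<lambda>i\<in>{..<length (Q m)}. \<eta> m i w) {..M}"
  shows "gaussian_process P D (mra_process C0 T Q M \<eta>) (\<lambda>_. 0)
    (\<lambda>s1 s2. \<Sum>m\<le>M. kernel_row (mra_v C0 T Q m) s1 (Q m)
       \<bullet> (inv_mat (kernel_mat (mra_v C0 T Q m) (Q m) (Q m))
           *\<^sub>v kernel_col (mra_v C0 T Q m) (Q m) s2))"
proof -
  interpret prob_space P by (rule prob)
  let ?v = "mra_v C0 T Q"
  define B where "B m = inv_mat (mra_Lambda C0 T Q m)" for m
  have B_carrier: "B m \<in> carrier_mat (length (Q m)) (length (Q m))" if "m \<le> M" for m
    unfolding B_def
    by (rule inv_mat_carrier[OF _ invertible[OF that]]) (simp add: mra_Lambda_def kernel_mat_def)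
  \<comment> \<open>\<open>B m\<close> is the covariance matrix of \<open>\<eta> m\<close>.\<close>
  have B_sym: "B m $$ (i, j) = B m $$ (j, i)"
    if "m \<le> M" "i < length (Q m)" "j < length (Q m)" for m i j
    using multivariate_normalD(6)[OF eta_normal, of m i j]
      multivariate_normalD(6)[OF eta_normal, of m j i] that
    by (simp add: B_def mult.commute)
  have v_sym: "symmetric_on D (?v m)" if "m \<le> M" for m
    by (rule symmetric_on_mra_v[OF C0_sym])
       (use that modulating B_carrier B_sym in \<open>auto simp: modulating_function_def B_def\<close>)
  define X where "X m s w = (\<Sum>i<length (Q m). ?v m s (Q m ! i) * \<eta> m i w)" for m s w
  have process: "mra_process C0 T Q M \<eta> = (\<lambda>s w. \<Sum>m\<le>M. X m s w)"
    by (simp add: fun_eq_iff mra_process_def mra_b_def X_def kernel_row_def scalar_prod_def lessThan_atLeast0)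
  have cov: "kernel_row (?v m) s (Q m) \<bullet>
        (inv_mat (kernel_mat (?v m) (Q m) (Q m)) *\<^sub>v kernel_col (?v m) (Q m) t)
      = (\<Sum>i<length (Q m). \<Sum>j<length (Q m). ?v m s (Q m ! i) * ?v m t (Q m ! j) * B m $$ (i, j))"
    if "m \<le> M" "t \<in> D" for m s t
  proof -
    have "Q m ! i \<in> D" if "i < length (Q m)" for i
      using knots[OF \<open>m \<le> M\<close>] that by (auto dest: nth_mem)
    \<comment> \<open>Symmetry of the kernel is known only on \<open>D\<close>, which contains the
      knots and \<open>t\<close>.\<close>
    then have "kernel_col (?v m) (Q m) t = kernel_row (?v m) t (Q m)"
      using v_sym that by (auto simp: kernel_col_def kernel_row_def symmetric_on_def)
    then show ?thesis
      using scalar_prod_kernel_row_mult_mat[OF B_carrier[OF \<open>m \<le> M\<close>], of "?v m" s "?v m" t]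
      by (simp add: B_def mra_Lambda_def)
  qed
  show ?thesis
    unfolding gaussian_process_def
  proof (intro conjI allI impI)
    show "prob_space P" by fact
    fix S assume S: "finite S \<and> S \<subseteq> D"
    have N: "multivariate_normal P S (X m) (\<lambda>_. 0) (\<lambda>s t. \<Sum>i<length (Q m).
        \<Sum>j<length (Q m). ?v m s (Q m ! i) * ?v m t (Q m ! j) * B m $$ (i, j))" if "m \<in> {..M}" for m
      using multivariate_normal_linear_image[OF eta_normal, of m S "\<lambda>s i. ?v m s (Q m ! i)"] S that
      by (simp add: X_def[abs_def] B_def)
    \<comment> \<open>Level \<open>m\<close> at all locations of \<open>S\<close> is a measurable
      function of the weight vector \<open>\<eta> m\<close> alone, so independence of the weights
      passes to the levels.\<close>
    have "indep_vars (\<lambda>_. \<Pi>\<^sub>M s\<in>S. borel)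
        (\<lambda>m w. \<lambda>s\<in>S. \<Sum>i<length (Q m). ?v m s (Q m ! i) * (\<lambda>i\<in>{..<length (Q m)}. \<eta> m i w) i) {..M}"
      by (rule indep_vars_compose2[OF eta_indep,
          of "\<lambda>m f. \<lambda>s\<in>S. \<Sum>i<length (Q m). ?v m s (Q m ! i) * f i"]) simp
    then have "indep_vars (\<lambda>_. \<Pi>\<^sub>M s\<in>S. borel) (\<lambda>m w. \<lambda>s\<in>S. X m s w) {..M}"
      by (simp add: X_def cong: restrict_cong)
    with S N have "multivariate_normal P S (\<lambda>s w. \<Sum>m\<le>M. X m s w) (\<lambda>s. \<Sum>m\<le>M. 0)
        (\<lambda>s t. \<Sum>m\<le>M. \<Sum>i<length (Q m). \<Sum>j<length (Q m).
          ?v m s (Q m ! i) * ?v m t (Q m ! j) * B m $$ (i, j))"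
      by (intro multivariate_normal_sum_indep) auto
    \<comment> \<open>The two covariance functions are identified only at locations of
      \<open>D\<close>; \<open>multivariate_normal\<close> compares them only on \<open>S\<close>, a
      subset of \<open>D\<close>.\<close>
    then show "multivariate_normal P S (mra_process C0 T Q M \<eta>) (\<lambda>_. 0)
        (\<lambda>s1 s2. \<Sum>m\<le>M. kernel_row (?v m) s1 (Q m)
          \<bullet> (inv_mat (kernel_mat (?v m) (Q m) (Q m)) *\<^sub>v kernel_col (?v m) (Q m) s2))"
      using S by (auto simp: multivariate_normal_def process cov subset_iff)
  qed
qed

end
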